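(* Let $p$ be an odd prime, $s$ a positive integer, $\lambda$ an odd integer with $-p^s<\lambda<p^s$, and $i\in\{1,2\}$. Then the column vector $I_s(\boldsymbol z;\lambda)$ satisfies $$\mathcal D_i(\lambda)\, I_s(\boldsymbol z;\lambda)\equiv 0 \pmod{p^s},\qquad\text{where } \mathcal D_i(\lambda)=2z_i\frac{\partial}{\partial z_i}-H_i(\boldsymbol z;\lambda).$$
   Context: Let $\boldsymbol z=(z_1,z_2)$. For an odd integer $\lambda$ with $-p^s<\lambda<p^s$ put $$\Phi_s(t;\boldsymbol z;\lambda)=t^{(p^s-\lambda)/2}(t-z_1)^{(p^s-1)/2}(t-z_2)^{(p^s-1)/2}.$$ The column vector $I_s(\boldsymbol z;\lambda)=(I_{s,1}(\boldsymbol z;\lambda),I_{s,2}(\boldsymbol z;\lambda))$ has as $j$-th coordinate $I_{s,j}(\boldsymbol z;\lambda)\in\mathbb Z[z_1,z_2]$ the coefficient of $t^{p^s-1}$ in the polynomial $\Phi_s(t;\boldsymbol z;\lambda)/(t-z_j)$. The matrices are $$H_1(\boldsymbol z;\lambda)=\begin{bmatrix}-\lambda-1&-1\\0&0\end{bmatrix}+\frac{z_1}{z_1-z_2}\begin{bmatrix}-1&1\\1&-1\end{bmatrix},\qquad H_2(\boldsymbol z;\lambda)=\begin{bmatrix}0&0\\-1&-\lambda-1\end{bmatrix}+\frac{z_2}{z_2-z_1}\begin{bmatrix}-1&1\\1&-1\end{bmatrix}.$$ A congruence modulo $p^s$ between polynomials with integer coefficients means that all coefficients of the difference are divisible by $p^s$.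 For rational functions whose denominators $F_2,G_2\in\mathbb Z[z_1,z_2]$ are nonzero modulo $p$, $F_1/F_2\equiv G_1/G_2 \pmod{p^s}$ means $F_1G_2\equiv G_1F_2\pmod{p^s}$; here the denominators that occur are $z_1-z_2$. Congruences of vectors are coordinatewise. *)

theory Defs
  imports "HOL-Analysis.Analysis" "HOL-Computational_Algebra.Computational_Algebra"
begin

text \<open>
  \<open>\<int>[z\<^sub>1, z\<^sub>2]\<close> is represented as \<open>\<int>[z\<^sub>1][z\<^sub>2]\<close>: the inner polynomial variable is \<open>z\<^sub>1\<close>, the
  outer one is \<open>z\<^sub>2\<close>. Index \<open>1 :: 2\<close> stands for \<open>z\<^sub>1\<close> and the other element \<open>2 :: 2\<close>
  (which equals \<open>0 :: 2\<close>) for \<open>z\<^sub>2\<close>.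
\<close>

type_synonym zpoly = "int poly poly"

type_synonym zrat = "zpoly fract"

definition zvar :: "2 \<Rightarrow> zpoly" where
  "zvar i = (if i = 1 then [:[:0, 1:]:] else [:0, 1:])"

definition zderiv :: "2 \<Rightarrow> zpoly \<Rightarrow> zpoly" where
  "zderiv i F = (if i = 1 then map_poly pderiv F else pderiv F)"

abbreviation zrat_of :: "zpoly \<Rightarrow> zrat" where
  "zrat_of F \<equiv> Fraction_Field.Fract F 1"

definition zpoly_cong :: "nat \<Rightarrow> zpoly \<Rightarrow> zpoly \<Rightarrow> bool" where
  "zpoly_cong m F G \<longleftrightarrow> (\<forall>a b. int m dvd coeff (coeff (F - G) a) b)"

text \<open>
  For prime \<open>p\<close> the choice of the representing quotients below is immaterial, since the
  denominators are then non-zero-divisors modulo \<open>p ^ s\<close>.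
\<close>

definition zrat_cong :: "nat \<Rightarrow> nat \<Rightarrow> zrat \<Rightarrow> zrat \<Rightarrow> bool" where
  "zrat_cong p s F G \<longleftrightarrow>
     (\<exists>F\<^sub>1 F\<^sub>2 G\<^sub>1 G\<^sub>2. F = Fraction_Field.Fract F\<^sub>1 F\<^sub>2 \<and> G = Fraction_Field.Fract G\<^sub>1 G\<^sub>2 \<and>
        \<not> zpoly_cong p F\<^sub>2 0 \<and> \<not> zpoly_cong p G\<^sub>2 0 \<and>
        zpoly_cong (p ^ s) (F\<^sub>1 * G\<^sub>2) (G\<^sub>1 * F\<^sub>2))"

text \<open>
  The polynomial variable of the outermost layer of \<open>zpoly poly\<close> is \<open>t\<close>. The exponents are
  meant for odd \<open>p\<close> and odd \<open>lam\<close> with \<open>lam < p ^ s\<close>, where the divisions by 2 are exact.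
\<close>

definition Phi :: "nat \<Rightarrow> nat \<Rightarrow> int \<Rightarrow> zpoly poly" where
  "Phi p s lam = [:0, 1:] ^ nat ((int (p ^ s) - lam) div 2)
     * [:- zvar 1, 1:] ^ ((p ^ s - 1) div 2) * [:- zvar 2, 1:] ^ ((p ^ s - 1) div 2)"

text \<open>
  The \<open>div\<close> in the next definition is exact division in \<open>\<int>[z\<^sub>1, z\<^sub>2][t]\<close>, as shown by
  \<open>Phi_div_exact\<close>.
\<close>

definition I_vec :: "nat \<Rightarrow> nat \<Rightarrow> int \<Rightarrow> zpoly ^ 2" where
  "I_vec p s lam = (\<chi> j. coeff (Phi p s lam div [:- zvar j, 1:]) (p ^ s - 1))"

lemma Phi_div_exact:
  assumes "odd p" "p > 1" "s > 0"
  shows "(Phi p s lam div [:- zvar j, 1:]) * [:- zvar j, 1:] = Phi p s lam"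
proof -
  have "p ^ s > 1" "odd (p ^ s)"
    using assms one_less_power[of p s] by auto
  then have "p ^ s > 2"
    by (intro le_neq_implies_less) (linarith, metis even_numeral)
  then have "(p ^ s - 1) div 2 > 0"
    by (simp add: div_greater_zero_iff)
  then have "[:- zvar i, 1:] dvd [:- zvar i, 1:] ^ ((p ^ s - 1) div 2)" for i
    by (simp add: dvd_power)
  then have "[:- zvar j, 1:] dvd Phi p s lam"
    using exhaust_2[of j] unfolding Phi_def by (auto intro: dvd_mult dvd_mult2)
  then show ?thesis
    by (rule dvd_div_mult_self)
qed

definition H_mat :: "2 \<Rightarrow> int \<Rightarrow> zrat ^ 2 ^ 2" where
  "H_mat i lam =
     (if i = 1 then
        vector [vector [- of_int lam - 1, - 1], vector [0, 0]]
        + map_matrix ((*) (zrat_of (zvar 1) / (zrat_of (zvar 1) - zrat_of (zvar 2))))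
            (vector [vector [- 1, 1], vector [1, - 1]])
      else
        vector [vector [0, 0], vector [- 1, - of_int lam - 1]]
        + map_matrix ((*) (zrat_of (zvar 2) / (zrat_of (zvar 2) - zrat_of (zvar 1))))
            (vector [vector [- 1, 1], vector [1, - 1]]))"

definition D_op :: "2 \<Rightarrow> int \<Rightarrow> zpoly ^ 2 \<Rightarrow> zrat ^ 2" where
  "D_op i lam v = (\<chi> j. zrat_of (2 * zvar i * zderiv i (v $ j)))
     - H_mat i lam *v (\<chi> j. zrat_of (v $ j))"

end

theory Submission
  imports Defs
begin

text \<open>
  Write \<open>N = p ^ s\<close>, let \<open>x\<close> be the variable \<open>z\<^sub>i\<close> and \<open>y\<close> the other one, \<open>D = \<partial>/\<partial>x\<close>, and
  \<open>\<Phi> = t ^ a (t - x) ^ m (t - y) ^ m\<close> with \<open>2 a = N - \<lambda>\<close> and \<open>2 m = N - 1\<close>. The entries of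
  \<open>I\<^sub>s\<close> are the coefficients of \<open>t ^ (N - 1)\<close> in \<open>P = \<Phi> / (t - x)\<close> and \<open>Q = \<Phi> / (t - y)\<close>. The
  proof brings in the analogous coefficient of a third polynomial,
  \<open>R = \<Phi> / ((t - x) (t - y))\<close>, which clears the denominator of \<open>H\<^sub>i\<close>: \<open>(x - y) R = P - Q\<close>.

  Up to multiples of \<open>N\<close>, the two rows of the system then follow from two observations.
  In \<open>Q\<close> the factor \<open>t - x\<close> has exponent \<open>m\<close>, so \<open>2 D Q = - 2 m R = (1 - N) R\<close>.
  For \<open>P\<close>, one integrates by parts: the coefficient of \<open>t ^ (N - 1)\<close> in the \<open>t\<close>-derivative of
  \<open>t P\<close> is \<open>N\<close> times that of \<open>P\<close>, while the product rule and
  \<open>\<partial>/\<partial>t (t - x) ^ k = - D ((t - x) ^ k)\<close> turn this derivative into a combination of \<open>P\<close>, \<open>x D P\<close>,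
  \<open>Q\<close> and \<open>x R\<close> (lemma \<open>pderiv_pCons_0_master\<close>).

  All identities are exact, so the error term is explicit: \<open>\<D>\<^sub>i I\<^sub>s\<close> is a vector of integer
  polynomials multiplied by \<open>N\<close>, namely \<open>N (Q + x R)\<close> in the row of \<open>x\<close> and \<open>- N x R\<close> in the
  row of \<open>y\<close> (lemma \<open>D_op_I_vec\<close>).
\<close>

section \<open>Derivations and their coefficientwise extension\<close>

locale derivation =
  fixes D :: "'a::comm_ring_1 \<Rightarrow> 'a"
  assumes add: "D (f + g) = D f + D g"
    and mult: "D (f * g) = D f * g + f * D g"
begin

lemma zero: "D 0 = 0"
  using add[of 0 0] by simp

lemma one: "D 1 = 0"
  using mult[of 1 1] by simp

lemma minus: "D (- f) = - D f"
  using add[of f "- f"] zero by (simp add: eq_neg_iff_add_eq_0 add.commute)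

lemma sum: "D (sum f A) = (\<Sum>k\<in>A. D (f k))"
  by (induction A rule: infinite_finite_induct) (simp_all add: zero add)

lemma power: "D (f ^ n) * f = of_nat n * D f * f ^ n"
  by (induction n) (simp_all add: one mult algebra_simps)

lemma power_Suc: "D (f ^ Suc n) = of_nat (Suc n) * D f * f ^ n"
  using power[of f n] by (simp add: mult algebra_simps)

end

lemma derivation_pderiv: "derivation (pderiv :: 'a::idom poly \<Rightarrow> 'a poly)"
  by unfold_locales (simp_all add: pderiv_add pderiv_mult algebra_simps)

text \<open>
  Used twice: to see that \<open>\<partial>/\<partial>z\<^sub>1\<close>, which acts on the inner layer of \<open>\<int>[z\<^sub>1][z\<^sub>2]\<close>, is a derivation,
  and to let \<open>\<partial>/\<partial>z\<^sub>i\<close> act on polynomials in \<open>t\<close> with \<open>t\<close> as a constant.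
\<close>

lemma derivation_map_poly:
  assumes "derivation D"
  shows "derivation (map_poly D)"
proof -
  interpret derivation D by fact
  show ?thesis
    by unfold_locales
      (simp_all add: poly_eq_iff coeff_map_poly coeff_mult zero add sum mult sum.distrib)
qed

lemma derivation_zderiv: "derivation (zderiv i)"
proof (cases "i = 1")
  case True
  then have "zderiv i = map_poly pderiv"
    by (simp add: zderiv_def fun_eq_iff)
  then show ?thesis
    by (simp add: derivation_map_poly derivation_pderiv)
next
  case False
  then have "zderiv i = pderiv"
    by (simp add: zderiv_def fun_eq_iff)
  then show ?thesis
    by (simp add: derivation_pderiv)
qed

lemma zderiv_zvar: "zderiv i (zvar j) = (if i = j then 1 else 0)"
proof (cases "i = 1"; cases "j = 1")
  assume "i \<noteq> 1" "j \<noteq> 1"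
  then have "i = j"
    using exhaust_2[of i] exhaust_2[of j] by auto
  then show ?thesis
    using \<open>i \<noteq> 1\<close> by (simp add: zderiv_def zvar_def pderiv_pCons)
qed (auto simp: zderiv_def zvar_def pderiv_pCons map_poly_pCons pCons_one
    derivation.one[OF derivation_map_poly, OF derivation_pderiv])

section \<open>The master polynomial with shifted exponents\<close>

text \<open>
  With the exponents \<open>(k, m)\<close> equal to \<open>(m - 1, m)\<close>, \<open>(m, m - 1)\<close> and \<open>(m - 1, m - 1)\<close> these
  are \<open>P\<close>, \<open>Q\<close> and \<open>R\<close>, where \<open>2 m = N - 1\<close>; the lemmas below shift \<open>m\<close> by 1.
\<close>

definition master :: "'a::comm_ring_1 \<Rightarrow> 'a \<Rightarrow> nat \<Rightarrow> nat \<Rightarrow> nat \<Rightarrow> 'a poly" where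
  "master x y a k m = [:0, 1:] ^ a * [:- x, 1:] ^ k * [:- y, 1:] ^ m"

lemma master_Suc_left: "master x y a (Suc k) m = master x y a k m * [:- x, 1:]"
  by (simp only: master_def power_Suc mult_ac)

lemma master_Suc_right: "master x y a k (Suc m) = master x y a k m * [:- y, 1:]"
  by (simp only: master_def power_Suc mult_ac)

lemma master_swap: "master x y a k m = master y x a m k"
  by (simp only: master_def power_Suc mult_ac)

text \<open>Here \<open>(x - y) R = ((t - y) - (t - x)) R = P - Q\<close>.\<close>

lemma coeff_master_diff:
  "(x - y) * coeff (master x y a k m) n
     = coeff (master x y a k (Suc m)) n - coeff (master x y a (Suc k) m) n"
  by (simp add: master_Suc_left master_Suc_right algebra_simps)

context
  fixes D :: "'a::idom \<Rightarrow> 'a" and x y :: 'a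
  assumes D: "derivation D" and Dx: "D x = 1" and Dy: "D y = 0"
begin

interpretation D: derivation D by (fact D)
interpretation MD: derivation "map_poly D" by (rule derivation_map_poly) (fact D)
interpretation PD: derivation "pderiv :: 'a poly \<Rightarrow> 'a poly" by (rule derivation_pderiv)

lemma map_poly_D_power_const:
  assumes "D c = 0"
  shows "map_poly D ([:c, 1:] ^ n) = 0"
  using assms by (cases n)
    (simp_all only: MD.power_Suc power_0 MD.one, simp add: map_poly_pCons D.zero D.one)

lemma map_poly_D_x: "map_poly D [:- x, 1:] = - 1"
  by (simp add: map_poly_pCons D.zero D.one D.minus Dx one_pCons)

lemma map_poly_D_master:
  "map_poly D (master x y a k m)
     = [:0, 1:] ^ a * map_poly D ([:- x, 1:] ^ k) * [:- y, 1:] ^ m"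
  unfolding master_def
  by (simp add: MD.mult map_poly_D_power_const D.zero D.minus Dy)

lemma D_coeff_master_Suc:
  "D (coeff (master x y a (Suc k) m) n) = - of_nat (Suc k) * coeff (master x y a k m) n"
proof -
  have "map_poly D (master x y a (Suc k) m) = - of_nat (Suc k) * master x y a k m"
    unfolding map_poly_D_master MD.power_Suc map_poly_D_x
    by (simp add: master_def algebra_simps)
  then have "coeff (map_poly D (master x y a (Suc k) m)) n
      = coeff (- of_nat (Suc k) * master x y a k m) n"
    by (rule arg_cong)
  then show ?thesis
    by (simp only: coeff_map_poly D.zero) (simp add: of_nat_poly algebra_simps)
qed

text \<open>
  The factor \<open>(t - x) ^ k\<close> is a function of \<open>t - x\<close> only, so that its \<open>t\<close>-derivative is minus its
  \<open>x\<close>-derivative; in the resulting term \<open>t D P\<close> the split \<open>t = (t - x) + x\<close> makes the first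
  part a multiple of \<open>P\<close>, by homogeneity in \<open>t - x\<close>.
\<close>

lemma pderiv_pCons_0_master:
  "pderiv ([:0, 1:] * master x y a k (Suc m))
     = of_nat (Suc a + k) * master x y a k (Suc m) - smult x (map_poly D (master x y a k (Suc m)))
       + of_nat (Suc m) * (master x y a (Suc k) m + smult x (master x y a k m))"
proof -
  define T U V where "T = ([:0, 1:] :: 'a poly)" and "U = [:- x, 1:]" and "V = [:- y, 1:]"
  define E where "E = map_poly D (U ^ k)"
  have smult_x: "smult x f = (T - U) * f" for f
    by (simp add: T_def U_def)
  have dU: "map_poly D U = - 1" "pderiv U = 1"
    by (simp_all add: U_def map_poly_D_x pderiv_pCons)
  have "E * U = - of_nat k * U ^ k"
    using MD.power[of U k] by (simp add: E_def dU)
  moreover have "pderiv (U ^ k) = - E"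
  proof (cases k)
    case (Suc n)
    then show ?thesis
      by (simp only: E_def MD.power_Suc PD.power_Suc dU) (simp add: algebra_simps)
  qed (simp add: E_def MD.one)
  moreover have "pderiv (T ^ Suc a) = of_nat (Suc a) * T ^ a"
    "pderiv (V ^ Suc m) = of_nat (Suc m) * V ^ m"
    by (simp_all only: PD.power_Suc) (simp_all add: T_def V_def pderiv_pCons)
  ultimately have EU: "E * U = - of_nat k * U ^ k"
    and d: "pderiv (T ^ Suc a * U ^ k * V ^ Suc m)
      = of_nat (Suc a) * T ^ a * U ^ k * V ^ Suc m - T ^ Suc a * E * V ^ Suc m
        + T ^ Suc a * U ^ k * (of_nat (Suc m) * V ^ m)"
    by (simp_all only: PD.mult) (simp add: algebra_simps)
  have "pderiv (T * (T ^ a * U ^ k * V ^ Suc m))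
     = of_nat (Suc a + k) * (T ^ a * U ^ k * V ^ Suc m) - (T - U) * (T ^ a * E * V ^ Suc m)
       + of_nat (Suc m) * (T ^ a * U ^ Suc k * V ^ m + (T - U) * (T ^ a * U ^ k * V ^ m))"
  proof -
    have "T * (T ^ a * U ^ k * V ^ Suc m) = T ^ Suc a * U ^ k * V ^ Suc m"
      by (simp add: mult_ac)
    moreover have "(T - U) * (T ^ a * E * V ^ Suc m)
        = T ^ Suc a * E * V ^ Suc m - T ^ a * (E * U) * V ^ Suc m"
      by (simp add: algebra_simps)
    ultimately show ?thesis
      by (simp only: d EU) (simp add: algebra_simps)
  qed
  then show ?thesis
    unfolding smult_x map_poly_D_master
    by (simp only: master_def E_def T_def U_def V_def)
qed

text \<open>
  Comparing coefficients of \<open>t ^ n\<close>: the derivative of \<open>t P\<close> contributes \<open>n + 1\<close> times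
  the coefficient of \<open>P\<close>. For \<open>n = p ^ s - 1\<close> this is the multiple of \<open>p ^ s\<close> that makes the row
  of \<open>x\<close> hold modulo \<open>p ^ s\<close>.
\<close>

lemma D_coeff_master_row:
  "x * D (coeff (master x y a k (Suc m)) n)
     = (of_nat (Suc a + k) - of_nat (Suc n)) * coeff (master x y a k (Suc m)) n
       + of_nat (Suc m) * (coeff (master x y a (Suc k) m) n + x * coeff (master x y a k m) n)"
proof -
  have "coeff (pderiv ([:0, 1:] * master x y a k (Suc m))) n
      = of_nat (Suc n) * coeff (master x y a k (Suc m)) n"
    by (simp add: coeff_pderiv)
  then show ?thesis
    unfolding pderiv_pCons_0_master
    by (simp add: of_nat_poly coeff_map_poly D.zero algebra_simps)
qed

end

section \<open>The operator applied to the solution vector\<close>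

lemma Phi_eq_master:
  assumes "i \<noteq> j"
  shows "Phi p s lam = master (zvar i) (zvar j) (nat ((int (p ^ s) - lam) div 2))
     ((p ^ s - 1) div 2) ((p ^ s - 1) div 2)"
  using assms exhaust_2[of i] exhaust_2[of j]
  by (auto simp: Phi_def master_def mult_ac)

lemma I_vec_eq_coeff_master:
  assumes "i \<noteq> j" and "(p ^ s - 1) div 2 = Suc m"
  shows "I_vec p s lam $ i = coeff (master (zvar i) (zvar j)
     (nat ((int (p ^ s) - lam) div 2)) m (Suc m)) (p ^ s - 1)"
proof -
  have "Phi p s lam = master (zvar i) (zvar j) (nat ((int (p ^ s) - lam) div 2)) m (Suc m)
      * [:- zvar i, 1:]"
    using assms by (simp only: Phi_eq_master[OF assms(1)] master_Suc_left)
  then have "Phi p s lam div [:- zvar i, 1:]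
      = master (zvar i) (zvar j) (nat ((int (p ^ s) - lam) div 2)) m (Suc m)"
    by (simp only: nonzero_mult_div_cancel_right pCons_eq_0_iff one_neq_zero simp_thms)
  then show ?thesis
    by (simp only: I_vec_def vec_lambda_beta)
qed

lemma zvar_neq: "i \<noteq> j \<Longrightarrow> zvar i \<noteq> zvar j"
  using zderiv_zvar[of i i] zderiv_zvar[of i j] by auto

lemma zrat_of_simps:
  "zrat_of (f + g) = zrat_of f + zrat_of g"
  "zrat_of (f - g) = zrat_of f - zrat_of g"
  "zrat_of (- f) = - zrat_of f"
  "zrat_of (f * g) = zrat_of f * zrat_of g"
  by simp_all

lemma zrat_of_numbers:
  "zrat_of 1 = 1" "zrat_of 2 = 2" "zrat_of (of_int k) = of_int k"
proof -
  show one: "zrat_of 1 = 1"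
    by (simp add: One_fract_def)
  have "zrat_of (1 + 1) = 1 + 1"
    unfolding zrat_of_simps one by simp
  then show "zrat_of 2 = 2"
    by simp
  have nat: "zrat_of (of_nat n) = of_nat n" for n
    by (induction n) (simp_all only: of_nat_0 of_nat_Suc zrat_of_simps one Zero_fract_def)
  show "zrat_of (of_int k) = of_int k"
    by (cases k) (simp_all only: of_int_of_nat_eq of_int_minus zrat_of_simps nat)
qed

text \<open>
  The two cases of the system differ by exchanging the roles of the variables, and so do the
  matrices; this is the common form.
\<close>

lemma D_op_nth:
  fixes i j :: 2 and lam :: int and v :: "zpoly ^ 2"
  assumes "i \<noteq> j"
  defines "c \<equiv> zrat_of (zvar i) / (zrat_of (zvar i) - zrat_of (zvar j))"
  shows "D_op i lam v $ i = zrat_of (2 * zvar i * zderiv i (v $ i) + (of_int lam + 1) * v $ i + v $ j)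
           + c * zrat_of (v $ i - v $ j)"
    and "D_op i lam v $ j = zrat_of (2 * zvar i * zderiv i (v $ j)) - c * zrat_of (v $ i - v $ j)"
proof -
  have "i = 1 \<and> j = 2 \<or> i = 2 \<and> j = 1"
    using assms(1) exhaust_2[of i] exhaust_2[of j] by auto
  then show "D_op i lam v $ i = zrat_of (2 * zvar i * zderiv i (v $ i) + (of_int lam + 1) * v $ i + v $ j)
           + c * zrat_of (v $ i - v $ j)"
    and "D_op i lam v $ j = zrat_of (2 * zvar i * zderiv i (v $ j)) - c * zrat_of (v $ i - v $ j)"
    unfolding c_def zrat_of_simps zrat_of_numbers
    by (auto simp: D_op_def H_mat_def matrix_vector_mult_def map_matrix_def sum_2 vector_2
        zrat_of_simps zrat_of_numbers algebra_simps diff_divide_distrib simp del: mult_fract add_fract diff_fract minus_fract)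
qed

text \<open>
  Multiplied by 2, the coefficient identities for \<open>P\<close> and \<open>Q\<close> involve the exponents only through
  \<open>2 a = N - \<lambda>\<close> and \<open>2 (m + 1) = N - 1\<close>. The terms without a factor \<open>N\<close> form the system itself,
  once \<open>x r\<close> is rewritten as \<open>x / (x - y) (P - Q)\<close>.
\<close>

lemma D_op_I_vec:
  fixes i j :: 2 and lam :: int
  assumes "i \<noteq> j" and "odd lam" and "lam < int (p ^ s)" and N: "p ^ s = 2 * Suc m + 1"
  defines "r \<equiv> coeff (master (zvar i) (zvar j) (nat ((int (p ^ s) - lam) div 2)) m m) (p ^ s - 1)"
  shows "D_op i lam (I_vec p s lam) $ i
      = zrat_of (of_nat (p ^ s) * (I_vec p s lam $ j + zvar i * r))" (is ?row_i)
    and "D_op i lam (I_vec p s lam) $ j = zrat_of (- of_nat (p ^ s) * zvar i * r)" (is ?row_j)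
proof -
  define a where "a = nat ((int (p ^ s) - lam) div 2)"
  define x y where "x = zvar i" and "y = zvar j"
  define P where "P = I_vec p s lam $ i"
  define Q where "Q = I_vec p s lam $ j"
  have m: "(p ^ s - 1) div 2 = Suc m"
    by (simp add: N)
  have "even (int (p ^ s) - lam)"
    using \<open>odd lam\<close> by (simp add: N)
  then have "2 * int a = int (p ^ s) - lam"
    using \<open>lam < int (p ^ s)\<close> by (simp add: a_def)
  then have "of_int (2 * int a) = (of_int (int (p ^ s) - lam) :: zpoly)"
    by (rule arg_cong)
  then have two_a: "2 * of_nat a = (of_nat (p ^ s) - of_int lam :: zpoly)"
    by (simp only: of_int_mult of_int_diff of_int_numeral of_int_of_nat_eq)
  have two_m: "of_nat (p ^ s) = (2 * of_nat m + 3 :: zpoly)"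
    by (simp add: N)
  have P: "P = coeff (master x y a m (Suc m)) (p ^ s - 1)"
    unfolding P_def x_def y_def a_def using \<open>i \<noteq> j\<close> m by (rule I_vec_eq_coeff_master)
  have Q: "Q = coeff (master x y a (Suc m) m) (p ^ s - 1)"
    unfolding Q_def x_def y_def a_def master_swap[of "zvar i"]
    using \<open>i \<noteq> j\<close>[symmetric] m by (rule I_vec_eq_coeff_master)
  have r: "r = coeff (master x y a m m) (p ^ s - 1)"
    by (simp only: r_def x_def y_def a_def)
  have diff: "(x - y) * r = P - Q"
    unfolding P Q r by (rule coeff_master_diff)
  have x: "zderiv i x = 1" and y: "zderiv i y = 0"
    using \<open>i \<noteq> j\<close> by (simp_all add: x_def y_def zderiv_zvar)
  note D_rules = derivation_zderiv[of i] x y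
  have DQ: "zderiv i Q = - of_nat (Suc m) * r"
    unfolding Q r by (rule D_coeff_master_Suc[OF D_rules])
  have "Suc (p ^ s - 1) = p ^ s"
    by (simp add: N)
  then have DP: "x * zderiv i P
      = (of_nat (Suc a + m) - of_nat (p ^ s)) * P + of_nat (Suc m) * (Q + x * r)"
    using D_coeff_master_row[OF D_rules, of a m m "p ^ s - 1"] unfolding P Q r by simp
  have "zrat_of x - zrat_of y \<noteq> 0"
    using zvar_neq[OF \<open>i \<noteq> j\<close>] by (simp add: x_def y_def eq_fract Zero_fract_def)
  moreover have "zrat_of (P - Q) = (zrat_of x - zrat_of y) * zrat_of r"
    by (simp only: diff[symmetric] zrat_of_simps)
  ultimately have c: "zrat_of x / (zrat_of x - zrat_of y) * zrat_of (P - Q) = zrat_of (x * r)"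
    by (simp only: zrat_of_simps) (simp del: mult_fract diff_fract)
  have "2 * x * zderiv i P + (of_int lam + 1) * P + Q + x * r = of_nat (p ^ s) * (Q + x * r)"
  proof -
    have "2 * x * zderiv i P = (2 * of_nat a + 2 * of_nat m + 2 - 2 * of_nat (p ^ s)) * P
        + (2 * of_nat m + 2) * (Q + x * r)"
      using arg_cong[OF DP, of "\<lambda>f. 2 * f"] by (simp add: algebra_simps)
    then show ?thesis
      unfolding two_a by (simp only: two_m) (simp add: algebra_simps)
  qed
  moreover have "D_op i lam (I_vec p s lam) $ i
      = zrat_of (2 * x * zderiv i P + (of_int lam + 1) * P + Q + x * r)"
    by (simp only: D_op_nth(1)[OF \<open>i \<noteq> j\<close>] c zrat_of_simps(1)
        flip: P_def Q_def x_def y_def)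
  ultimately show ?row_i
    by (simp only: x_def Q_def)
  have "2 * x * zderiv i Q - x * r = - of_nat (p ^ s) * x * r"
    unfolding DQ two_m by (simp add: algebra_simps)
  moreover have "D_op i lam (I_vec p s lam) $ j = zrat_of (2 * x * zderiv i Q - x * r)"
    by (simp only: D_op_nth(2)[OF \<open>i \<noteq> j\<close>] c
        flip: P_def Q_def x_def y_def) (simp only: zrat_of_simps(2))
  ultimately show ?row_j
    by (simp only: x_def)
qed

text \<open>
  An integral multiple of \<open>p ^ s\<close> can be written with both denominators equal to 1, which is
  nonzero modulo \<open>p\<close>.
\<close>

lemma zrat_cong_0I:
  assumes "p > 1" and "f = zrat_of (of_nat (p ^ s) * F)"
  shows "zrat_cong p s f 0"
proof -
  have "zpoly_cong (p ^ s) (of_nat (p ^ s) * F * 1) (0 * 1)"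
    by (simp add: zpoly_cong_def of_nat_poly flip: of_nat_power)
  moreover have "\<not> zpoly_cong p 1 0"
    using \<open>p > 1\<close> by (auto simp: zpoly_cong_def intro!: exI[of _ 0])
  ultimately show ?thesis
    unfolding zrat_cong_def using assms(2) Zero_fract_def by blast
qed

theorem theorem3p1:
  fixes p s :: nat and lam :: int and i :: 2
  assumes "prime p" and "odd p" and "s > 0"
    and "odd lam" and "- int (p ^ s) < lam" and "lam < int (p ^ s)"
  shows "\<forall>j. zrat_cong p s (D_op i lam (I_vec p s lam) $ j) 0"
proof -
  have "p > 1"
    using \<open>prime p\<close> by (rule prime_gt_1_nat)
  then have "p ^ s > 1"
    using \<open>s > 0\<close> by (rule one_less_power)
  moreover have "odd (p ^ s)"
    using \<open>odd p\<close> by simp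
  ultimately obtain m where N: "p ^ s = 2 * Suc m + 1"
    by (metis One_nat_def add_0 less_irrefl mult_0_right not0_implies_Suc oddE)
  obtain k where "i \<noteq> k" and k: "j = i \<or> j = k" for j
    using exhaust_2 by (metis zero_neq_one)
  note rows = D_op_I_vec[OF \<open>i \<noteq> k\<close> \<open>odd lam\<close> \<open>lam < int (p ^ s)\<close> N]
  have "zrat_cong p s (D_op i lam (I_vec p s lam) $ i) 0"
    using \<open>p > 1\<close> rows(1) by (rule zrat_cong_0I)
  moreover have "zrat_cong p s (D_op i lam (I_vec p s lam) $ k) 0"
    using \<open>p > 1\<close> rows(2)[unfolded mult.assoc minus_mult_commute] by (rule zrat_cong_0I)
  ultimately show ?thesis
    using k by metis
qed

end
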